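(* Let $T_n$ be the number of $p_2$-configurations $C$ on the path $P_n$ with $|v_1|^C=0$ (equivalently, the number of $p_2$-configurations on $P_n$ up to adding a common integer constant to all stack sizes). Then $T_1=0$, $T_2=2$, $T_3=8$, $T_4=26$, and for all $n\ge 5$, $$T_n = 3T_{n-1}+2T_{n-2}+T_{n-3}-T_{n-4}.$$
   Context: Parallel Diffusion on a finite simple graph $G$: a configuration assigns an integer stack size $|v|$ (possibly negative) to each vertex. In one step all vertices fire simultaneously: each vertex sends one chip to each neighbour with strictly smaller stack size, so the new stack size of $v$ is $|v|+\#\{u\sim v:|u|>|v|\}-\#\{u\sim v:|u|<|v|\}$. Starting from $C_0$, $C_{t+1}$ is obtained from $C_t$ by one step. A configuration $D$ is a $p_2$-configuration if there are $C_0$ and $N$ such that $C_{t+2}=C_t$ and $C_{t+1}\ne C_t$ for all $t\ge N$, and $D=C_t$ for some $t\ge N$ (equivalently, starting from $D$ one has $D_2=D\ne D_1$). The path $P_n$ has vertices $v_1,\dots,v_n$ and edges $v_iv_{i+1}$. *)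

theory Defs
  imports "HOL-Library.FuncSet"
begin

definition finite_simple_graph :: "'a set \<Rightarrow> 'a set set \<Rightarrow> bool" where
  "finite_simple_graph V E \<longleftrightarrow> finite V \<and> (\<forall>e\<in>E. e \<subseteq> V \<and> card e = 2)"

definition neighbours :: "'a set \<Rightarrow> 'a set set \<Rightarrow> 'a \<Rightarrow> 'a set" where
  "neighbours V E v = {u \<in> V. {u, v} \<in> E}"

text \<open>Configurations take the value \<open>undefined\<close> outside the vertex set, so that
  equality of configurations is equality on the vertices and counting them is meaningful.\<close>

definition configurations :: "'a set \<Rightarrow> ('a \<Rightarrow> int) set" where
  "configurations V = V \<rightarrow>\<^sub>E UNIV"

definition diffusion_step :: "'a set \<Rightarrow> 'a set set \<Rightarrow> ('a \<Rightarrow> int) \<Rightarrow> ('a \<Rightarrow> int)" where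
  "diffusion_step V E C =
     (\<lambda>v\<in>V. C v + int (card {u \<in> neighbours V E v. C u > C v})
                - int (card {u \<in> neighbours V E v. C u < C v}))"

definition diffusion :: "'a set \<Rightarrow> 'a set set \<Rightarrow> ('a \<Rightarrow> int) \<Rightarrow> nat \<Rightarrow> ('a \<Rightarrow> int)" where
  "diffusion V E C0 t = (diffusion_step V E ^^ t) C0"

definition p2_configuration :: "'a set \<Rightarrow> 'a set set \<Rightarrow> ('a \<Rightarrow> int) \<Rightarrow> bool" where
  "p2_configuration V E D \<longleftrightarrow>
     (\<exists>C0 \<in> configurations V. \<exists>N.
        (\<forall>t\<ge>N. diffusion V E C0 (t + 2) = diffusion V E C0 t \<and>
               diffusion V E C0 (t + 1) \<noteq> diffusion V E C0 t) \<and>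
        (\<exists>t\<ge>N. D = diffusion V E C0 t))"

definition path_verts :: "nat \<Rightarrow> nat set" where
  "path_verts n = {1..n}"

definition path_edges :: "nat \<Rightarrow> nat set set" where
  "path_edges n = {{i, i + 1} | i. 1 \<le> i \<and> i < n}"

lemma finite_simple_graph_path: "finite_simple_graph (path_verts n) (path_edges n)"
  by (auto simp: finite_simple_graph_def path_verts_def path_edges_def)

definition path_p2_configurations :: "nat \<Rightarrow> (nat \<Rightarrow> int) set" where
  "path_p2_configurations n = {C. p2_configuration (path_verts n) (path_edges n) C \<and> C 1 = 0}"

definition T :: "nat \<Rightarrow> nat" where
  "T n = card (path_p2_configurations n)"

end

theory Submission
  imports Defs
begin

text \<open>Let \<open>d\<^sub>i\<close> be the difference of the stacks at \<open>v\<^sub>i\<^sub>+\<^sub>1\<close> and \<open>v\<^sub>i\<close>, and \<open>s\<^sub>i\<close> its sign, which is the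
  number of chips sent from \<open>v\<^sub>i\<^sub>+\<^sub>1\<close> to \<open>v\<^sub>i\<close>. Two steps restore a configuration iff the flows
  of the two steps cancel at every vertex; since no chips cross the ends of the path, they
  then cancel on every edge, i.e. one step reverses every sign:
  \<open>sgn (d\<^sub>i + s\<^sub>i\<^sub>-\<^sub>1 - 2 s\<^sub>i + s\<^sub>i\<^sub>+\<^sub>1) = - s\<^sub>i\<close>. This is a local condition on the list of differences, so
  the lists are counted by a transfer matrix on pairs of consecutive signs. Up to a global sign
  change, the transitions between nonzero signs yield three coupled recurrences, and eliminating
  two of the sequences leaves the claimed one.\<close>

subsection \<open>Period two in terms of differences\<close>

lemma card_greater_minus_card_less:
  fixes f :: "'a \<Rightarrow> int"
  assumes "finite A"
  shows "int (card {u \<in> A. f u > x}) - int (card {u \<in> A. f u < x}) = (\<Sum>u\<in>A. sgn (f u - x))"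
  using assms
proof (induction rule: finite_induct)
  case empty
  show ?case by simp
next
  case (insert a A)
  have "{u \<in> insert a A. P u} = (if P a then insert a {u \<in> A. P u} else {u \<in> A. P u})" for P
    by auto
  then have card: "card {u \<in> insert a A. P u} = card {u \<in> A. P u} + (if P a then 1 else 0)" for P
    using insert.hyps by simp
  show ?case
    unfolding card sum.insert[OF insert.hyps] insert.IH[symmetric]
    by (cases "f a" x rule: linorder_cases) simp_all
qed

text \<open>Net number of chips crossing from vertex \<open>i + 1\<close> to vertex \<open>i\<close>
  in one step. The value 0 at \<open>i = 0\<close> and \<open>i = n\<close> stands for phantom edges
  at both ends, so that the update formula needs no boundary cases.\<close>

definition flow :: "nat \<Rightarrow> (nat \<Rightarrow> int) \<Rightarrow> nat \<Rightarrow> int" where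
  "flow n C i = (if 1 \<le> i \<and> i < n then sgn (C (Suc i) - C i) else 0)"

lemma flow_0 [simp]: "flow n C 0 = 0"
  and flow_end [simp]: "flow n C n = 0"
  by (simp_all add: flow_def)

lemma neighbours_path:
  assumes "v \<in> path_verts n"
  shows "neighbours (path_verts n) (path_edges n) v
    = (if v < n then {Suc v} else {}) \<union> (if 1 < v then {v - 1} else {})"
proof -
  have edge: "{u, v} \<in> path_edges n \<longleftrightarrow> (u = Suc v \<and> 1 \<le> v \<and> v < n) \<or> (v = Suc u \<and> 1 \<le> u \<and> u < n)" for u
    by (auto simp: path_edges_def doubleton_eq_iff)
  show ?thesis
    unfolding neighbours_def edge using assms by (auto simp: path_verts_def)
qed

lemma step_path:
  assumes "v \<in> path_verts n"
  shows "diffusion_step (path_verts n) (path_edges n) C v = C v + flow n C v - flow n C (v - 1)"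
proof -
  let ?N = "neighbours (path_verts n) (path_edges n) v"
  have "finite ?N"
    by (simp add: neighbours_path[OF assms])
  then have "int (card {u \<in> ?N. C u > C v}) - int (card {u \<in> ?N. C u < C v})
      = (\<Sum>u\<in>?N. sgn (C u - C v))"
    by (rule card_greater_minus_card_less)
  also have "\<dots> = flow n C v - flow n C (v - 1)"
  proof -
    have "1 \<le> v" "v \<le> n" using assms by (auto simp: path_verts_def)
    moreover have "sgn (C (v - 1) - C v) = - sgn (C v - C (v - 1))"
      by (metis minus_diff_eq sgn_minus)
    ultimately show ?thesis
      by (auto simp: neighbours_path[OF assms] flow_def)
  qed
  finally show ?thesis
    using assms by (simp add: diffusion_step_def)
qed

lemma diffusion_step_in_configurations: "diffusion_step V E C \<in> configurations V"
  by (simp add: diffusion_step_def configurations_def)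

text \<open>Such a \<open>D\<close> can serve as its own starting configuration with threshold 0:
  its orbit only alternates between \<open>D\<close> and its successor.\<close>

lemma p2_configuration_iff:
  "p2_configuration V E D \<longleftrightarrow> D \<in> configurations V
    \<and> diffusion_step V E (diffusion_step V E D) = D \<and> diffusion_step V E D \<noteq> D"
  (is "_ \<longleftrightarrow> ?R")
proof
  assume "p2_configuration V E D"
  then obtain C0 N t where C0: "C0 \<in> configurations V"
    and per: "\<forall>t\<ge>N. diffusion V E C0 (t + 2) = diffusion V E C0 t
      \<and> diffusion V E C0 (t + 1) \<noteq> diffusion V E C0 t"
    and "t \<ge> N" and D: "D = diffusion V E C0 t"
    unfolding p2_configuration_def by blast
  have "diffusion V E C0 t \<in> configurations V"
    using C0 by (cases t) (simp_all add: diffusion_def diffusion_step_in_configurations)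
  then show ?R
    using per \<open>t \<ge> N\<close> D by (auto simp: diffusion_def)
next
  assume R: ?R
  have "diffusion V E D t = D \<or> diffusion V E D t = diffusion_step V E D" for t
    using R by (induction t) (auto simp: diffusion_def)
  then have "\<forall>t\<ge>0. diffusion V E D (t + 2) = diffusion V E D t
      \<and> diffusion V E D (t + 1) \<noteq> diffusion V E D t"
    using R by (auto simp: diffusion_def) metis+
  moreover have "D = diffusion V E D 0"
    by (simp add: diffusion_def)
  ultimately show "p2_configuration V E D"
    using R unfolding p2_configuration_def by blast
qed

lemma step_path_eq_iff:
  assumes "C \<in> configurations (path_verts n)"
  shows "diffusion_step (path_verts n) (path_edges n) D = C
    \<longleftrightarrow> (\<forall>v\<in>path_verts n. D v + flow n D v - flow n D (v - 1) = C v)"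
proof -
  let ?D' = "diffusion_step (path_verts n) (path_edges n) D"
  have "?D' = C \<longleftrightarrow> (\<forall>v\<in>path_verts n. ?D' v = C v)"
    using assms diffusion_step_in_configurations[of "path_verts n" "path_edges n" D]
    unfolding configurations_def by (blast intro: PiE_ext)
  then show ?thesis by (simp add: step_path)
qed

text \<open>Conservation from the left end: a quantity that agrees on both edges at each vertex
  keeps its value 0 from the phantom edge. It is applied to the flow of one step and to the summed
  flows of two steps.\<close>

lemma constant_along_path_iff:
  fixes g :: "nat \<Rightarrow> int"
  assumes "g 0 = 0"
  shows "(\<forall>v\<in>path_verts n. g v = g (v - 1)) \<longleftrightarrow> (\<forall>v\<in>path_verts n. g v = 0)"
proof
  assume *: "\<forall>v\<in>path_verts n. g v = g (v - 1)"
  have "v \<le> n \<Longrightarrow> g v = 0" for v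
    using * assms by (induction v) (auto simp: path_verts_def)
  then show "\<forall>v\<in>path_verts n. g v = 0"
    by (auto simp: path_verts_def)
next
  assume *: "\<forall>v\<in>path_verts n. g v = 0"
  have "g (v - 1) = 0" if "v \<in> path_verts n" for v
  proof -
    have "v - 1 = 0 \<or> v - 1 \<in> path_verts n"
      using that by (auto simp: path_verts_def)
    then show ?thesis using * assms by auto
  qed
  with * show "\<forall>v\<in>path_verts n. g v = g (v - 1)" by simp
qed

lemma p2_configuration_path_iff:
  "p2_configuration (path_verts n) (path_edges n) C \<longleftrightarrow> C \<in> configurations (path_verts n)
    \<and> (\<forall>i\<in>path_verts n. flow n (diffusion_step (path_verts n) (path_edges n) C) i = - flow n C i)
    \<and> (\<exists>i\<in>path_verts n. flow n C i \<noteq> 0)"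
proof (cases "C \<in> configurations (path_verts n)")
  case True
  let ?C' = "diffusion_step (path_verts n) (path_edges n) C"
  have "diffusion_step (path_verts n) (path_edges n) ?C' = C \<longleftrightarrow>
      (\<forall>v\<in>path_verts n. flow n C v + flow n ?C' v = flow n C (v - 1) + flow n ?C' (v - 1))"
    unfolding step_path_eq_iff[OF True] by (auto simp: step_path)
  also have "\<dots> \<longleftrightarrow> (\<forall>v\<in>path_verts n. flow n C v + flow n ?C' v = 0)"
    by (rule constant_along_path_iff) simp
  also have "\<dots> \<longleftrightarrow> (\<forall>v\<in>path_verts n. flow n ?C' v = - flow n C v)"
    by (simp add: add_eq_0_iff)
  finally have two: "diffusion_step (path_verts n) (path_edges n) ?C' = C \<longleftrightarrow> \<dots>" .
  have "?C' = C \<longleftrightarrow> (\<forall>v\<in>path_verts n. flow n C v = flow n C (v - 1))"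
    unfolding step_path_eq_iff[OF True] by auto
  also have "\<dots> \<longleftrightarrow> (\<forall>v\<in>path_verts n. flow n C v = 0)"
    by (rule constant_along_path_iff) simp
  finally show ?thesis
    using two True by (auto simp: p2_configuration_iff)
qed (simp add: p2_configuration_iff)

subsection \<open>Lists of differences\<close>

text \<open>The parameter \<open>a\<close> is the sign of the difference just before the list; past
  its last entry the sign counts as 0, matching the phantom edge.\<close>

fun reversing :: "int \<Rightarrow> int list \<Rightarrow> bool" where
  "reversing a [] \<longleftrightarrow> True"
| "reversing a (d # ds) \<longleftrightarrow>
     sgn (d + a - 2 * sgn d + (if ds = [] then 0 else sgn (hd ds))) = - sgn d
     \<and> reversing (sgn d) ds"

lemma reversing_iff_nth:
  "reversing a ds \<longleftrightarrow> (\<forall>i<length ds.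
     sgn (ds ! i + (if i = 0 then a else sgn (ds ! (i - 1))) - 2 * sgn (ds ! i)
       + (if Suc i < length ds then sgn (ds ! Suc i) else 0)) = - sgn (ds ! i))"
proof (induction ds arbitrary: a)
  case (Cons d ds)
  have split: "(\<forall>i<Suc k. P i) \<longleftrightarrow> P 0 \<and> (\<forall>i<k. P (Suc i))" for P k
    by (auto simp: less_Suc_eq_0_disj)
  \<comment> \<open>The sign handed to the recursive call is that of the left neighbour once indices
    are shifted by one.\<close>
  have prev: "(if i = 0 then sgn d else sgn (ds ! (i - 1))) = sgn ((d # ds) ! i)" for i
    by (cases i) auto
  show ?case
    unfolding reversing.simps Cons.IH list.size add_0_right add_Suc_right split prev
    by (auto simp: hd_conv_nth)
qed simp

definition differences :: "nat \<Rightarrow> (nat \<Rightarrow> int) \<Rightarrow> int list" where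
  "differences n C = map (\<lambda>i. C (Suc i) - C i) [1..<n]"

definition heights :: "nat \<Rightarrow> int list \<Rightarrow> nat \<Rightarrow> int" where
  "heights n ds = (\<lambda>i\<in>path_verts n. sum_list (take (i - 1) ds))"

lemma length_differences [simp]: "length (differences n C) = n - 1"
  by (simp add: differences_def)

lemma nth_differences: "i < n - 1 \<Longrightarrow> differences n C ! i = C (Suc (Suc i)) - C (Suc i)"
  by (simp add: differences_def)

lemma differences_heights:
  assumes "length ds = n - 1"
  shows "differences n (heights n ds) = ds"
proof (rule nth_equalityI)
  fix i assume "i < length (differences n (heights n ds))"
  then have "i < n - 1" and "Suc (Suc i) \<le> n" by simp_all
  then show "differences n (heights n ds) ! i = ds ! i"
    using assms by (simp add: nth_differences heights_def path_verts_def take_Suc_conv_app_nth)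
qed (use assms in simp)

lemma heights_differences:
  assumes "C \<in> configurations (path_verts n)" and "C 1 = 0"
  shows "heights n (differences n C) = C"
proof -
  have "k < n \<Longrightarrow> sum_list (take k (differences n C)) = C (Suc k)" for k
  proof (induction k)
    case 0
    then show ?case using assms by simp
  next
    case (Suc k)
    then have "k < n - 1" by simp
    with Suc show ?case by (simp add: take_Suc_conv_app_nth nth_differences)
  qed
  then have "heights n (differences n C) v = C v" if "v \<in> path_verts n" for v
    using that by (cases v) (auto simp: heights_def path_verts_def)
  moreover have "heights n (differences n C) \<in> configurations (path_verts n)"
    by (simp add: heights_def configurations_def)
  ultimately show ?thesis
    using assms(1) unfolding configurations_def by (metis PiE_ext)
qed

lemma reversing_differences_iff:
  "reversing 0 (differences n C) \<longleftrightarrow>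
    (\<forall>i\<in>path_verts n. flow n (diffusion_step (path_verts n) (path_edges n) C) i = - flow n C i)"
    (is "?L \<longleftrightarrow> ?R")
proof -
  let ?C' = "diffusion_step (path_verts n) (path_edges n) C"
  have local: "sgn (differences n C ! i
        + (if i = 0 then 0 else sgn (differences n C ! (i - 1)))
        - 2 * sgn (differences n C ! i)
        + (if Suc i < length (differences n C) then sgn (differences n C ! Suc i) else 0))
        = - sgn (differences n C ! i)
      \<longleftrightarrow> flow n ?C' (Suc i) = - flow n C (Suc i)" if "i < n - 1" for i
  proof -
    \<comment> \<open>List index \<open>i\<close> is the edge between vertices \<open>i + 1\<close>
      and \<open>i + 2\<close>. Its own flow enters the updates of both ends with opposite signs,
      hence the factor 2.\<close>
    have "?C' (Suc (Suc i)) - ?C' (Suc i) = C (Suc (Suc i)) - C (Suc i)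
        + flow n C i - 2 * flow n C (Suc i) + flow n C (Suc (Suc i))"
    proof -
      have "Suc i \<in> path_verts n" "Suc (Suc i) \<in> path_verts n"
        using that by (auto simp: path_verts_def)
      then show ?thesis by (simp add: step_path)
    qed
    moreover have "flow n C (Suc i) = sgn (differences n C ! i)"
      and "flow n C i = (if i = 0 then 0 else sgn (differences n C ! (i - 1)))"
      and "flow n C (Suc (Suc i))
        = (if Suc i < length (differences n C) then sgn (differences n C ! Suc i) else 0)"
      using that by (auto simp: flow_def nth_differences)
    moreover have "flow n ?C' (Suc i) = sgn (?C' (Suc (Suc i)) - ?C' (Suc i))"
      using that by (simp add: flow_def)
    ultimately show ?thesis
      using that by (simp add: nth_differences)
  qed
  have "?L \<longleftrightarrow> (\<forall>i<n - 1. flow n ?C' (Suc i) = - flow n C (Suc i))"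
    unfolding reversing_iff_nth using local by simp
  also have "\<dots> \<longleftrightarrow> ?R"
  proof
    assume *: "\<forall>i<n - 1. flow n ?C' (Suc i) = - flow n C (Suc i)"
    show ?R
    proof
      fix v assume "v \<in> path_verts n"
      \<comment> \<open>There is one more vertex than edges; at \<open>v = n\<close> both flows are
        0.\<close>
      then have "v = n \<or> v - 1 < n - 1 \<and> Suc (v - 1) = v"
        by (auto simp: path_verts_def)
      then show "flow n ?C' v = - flow n C v"
        using * by (metis flow_end minus_zero)
    qed
  qed (simp add: path_verts_def)
  finally show ?thesis .
qed

lemma nonzero_difference_iff:
  "(\<exists>d\<in>set (differences n C). d \<noteq> 0) \<longleftrightarrow> (\<exists>i\<in>path_verts n. flow n C i \<noteq> 0)"
  by (auto simp: differences_def flow_def path_verts_def sgn_0_0 split: if_splits)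

lemma bij_betw_differences:
  assumes "n \<ge> 1"
  shows "bij_betw (differences n) (path_p2_configurations n)
    {ds. length ds = n - 1 \<and> reversing 0 ds \<and> (\<exists>d\<in>set ds. d \<noteq> 0)}"
proof (rule bij_betw_byWitness[where f' = "heights n"])
  have conf: "heights n ds \<in> configurations (path_verts n)" "heights n ds 1 = 0" for ds
    using assms by (simp_all add: heights_def configurations_def path_verts_def)
  show "\<forall>C\<in>path_p2_configurations n. heights n (differences n C) = C"
    using heights_differences
    by (simp add: path_p2_configurations_def p2_configuration_path_iff)
  show "\<forall>ds\<in>{ds. length ds = n - 1 \<and> reversing 0 ds \<and> (\<exists>d\<in>set ds. d \<noteq> 0)}.
      differences n (heights n ds) = ds"
    by (simp add: differences_heights)
  show "differences n ` path_p2_configurations n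
      \<subseteq> {ds. length ds = n - 1 \<and> reversing 0 ds \<and> (\<exists>d\<in>set ds. d \<noteq> 0)}"
    by (auto simp: path_p2_configurations_def p2_configuration_path_iff
        reversing_differences_iff nonzero_difference_iff)
  show "heights n ` {ds. length ds = n - 1 \<and> reversing 0 ds \<and> (\<exists>d\<in>set ds. d \<noteq> 0)}
      \<subseteq> path_p2_configurations n"
    using conf
    by (auto simp: path_p2_configurations_def p2_configuration_path_iff differences_heights
        simp flip: reversing_differences_iff nonzero_difference_iff)
qed

subsection \<open>Transfer recurrences\<close>

text \<open>Admissible differences of sign \<open>b\<close> between neighbours of signs
  \<open>a\<close> and \<open>c\<close>; their number is the transfer matrix entry from the state
  \<open>(a, b)\<close> to \<open>(b, c)\<close>.\<close>

definition local_differences :: "int \<Rightarrow> int \<Rightarrow> int \<Rightarrow> int set" where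
  "local_differences a b c = {d. sgn d = b \<and> sgn (d + a - 2 * b + c) = - b}"

text \<open>For \<open>b = 1\<close> reversal says \<open>d + a - 2 + c < 0\<close>, which bounds
  \<open>d\<close> above; \<open>b = -1\<close> is the mirror image, and a zero difference stays
  zero only if its neighbours' signs cancel.\<close>

lemma local_differences_pos: "local_differences a 1 c = {1..1 - a - c}"
  and local_differences_neg: "local_differences a (-1) c = {-1 - a - c..-1}"
  and local_differences_zero: "local_differences a 0 c = (if a + c = 0 then {0} else {})"
  by (auto simp: local_differences_def sgn_if split: if_splits)

text \<open>Length \<open>Suc m\<close> guarantees a head, so that the pair of signs
  \<open>(a, b)\<close> is a state of the transfer matrix.\<close>

definition reversing_lists :: "int \<Rightarrow> int \<Rightarrow> nat \<Rightarrow> int list set" where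
  "reversing_lists a b m = {ds. length ds = Suc m \<and> reversing a ds \<and> sgn (hd ds) = b}"

lemma reversing_lists_0: "reversing_lists a b 0 = (\<lambda>d. [d]) ` local_differences a b 0"
  by (auto simp: reversing_lists_def local_differences_def length_Suc_conv)

lemma reversing_lists_Suc:
  "reversing_lists a b (Suc m) =
    (\<Union>c\<in>{-1, 0, 1}. (\<lambda>(d, ds). d # ds) ` (local_differences a b c \<times> reversing_lists b c m))"
proof (intro set_eqI iffI)
  fix ds assume "ds \<in> reversing_lists a b (Suc m)"
  moreover from this obtain d ds' where "ds = d # ds'" "length ds' = Suc m" "ds' \<noteq> []"
    by (auto simp: reversing_lists_def length_Suc_conv)
  moreover have "sgn (hd ds') \<in> {-1, 0, 1}"
    by (auto simp: sgn_if)
  ultimately show "ds \<in> (\<Union>c\<in>{-1, 0, 1}.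
      (\<lambda>(d, ds). d # ds) ` (local_differences a b c \<times> reversing_lists b c m))"
    by (intro UN_I[of "sgn (hd ds')"] image_eqI[of _ _ "(d, ds')"])
       (auto simp: reversing_lists_def local_differences_def)
qed (auto simp: reversing_lists_def local_differences_def)

lemma finite_local_differences: "b \<in> {-1, 0, 1} \<Longrightarrow> finite (local_differences a b c)"
  by (auto simp: local_differences_pos local_differences_neg local_differences_zero)

lemma finite_reversing_lists: "b \<in> {-1, 0, 1} \<Longrightarrow> finite (reversing_lists a b m)"
proof (induction m arbitrary: a b)
  case 0
  then show ?case by (simp only: reversing_lists_0 finite_local_differences finite_imageI)
next
  case (Suc m)
  then show ?case
    unfolding reversing_lists_Suc
    by (intro finite_UN_I finite_imageI finite_cartesian_product finite_local_differences) auto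
qed

definition N :: "int \<Rightarrow> int \<Rightarrow> nat \<Rightarrow> nat" where
  "N a b m = card (reversing_lists a b m)"

lemma N_0: "N a b 0 = card (local_differences a b 0)"
  by (simp add: N_def reversing_lists_0 card_image inj_on_def)

lemma N_Suc:
  assumes "b \<in> {-1, 0, 1}"
  shows "N a b (Suc m) = (\<Sum>c\<in>{-1, 0, 1}. card (local_differences a b c) * N b c m)"
proof -
  let ?A = "\<lambda>c. (\<lambda>(d, ds). d # ds) ` (local_differences a b c \<times> reversing_lists b c m)"
  have fin: "\<forall>c\<in>{-1, 0, 1}. finite (?A c)"
    using assms
    by (intro ballI finite_imageI finite_cartesian_product
        finite_local_differences finite_reversing_lists)
  have disj: "\<forall>c\<in>{-1, 0, 1}. \<forall>c'\<in>{-1, 0, 1}. c \<noteq> c' \<longrightarrow> ?A c \<inter> ?A c' = {}"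
    by (auto simp: reversing_lists_def)
  have "inj_on (\<lambda>(d, ds). d # ds) X" for X :: "(int \<times> int list) set"
    by (auto simp: inj_on_def)
  then have "card (?A c) = card (local_differences a b c) * N b c m" for c
    by (simp add: card_image card_cartesian_product N_def)
  then show ?thesis
    using card_UN_disjoint[OF _ fin disj] by (simp add: N_def reversing_lists_Suc)
qed

section \<open>Symmetry under negating all differences\<close>

lemma card_local_differences_uminus:
  "card (local_differences (- a) (- b) (- c)) = card (local_differences a b c)"
proof -
  have mem: "d \<in> local_differences (- a) (- b) (- c) \<longleftrightarrow> - d \<in> local_differences a b c" for d
  proof -
    have "- d + a - 2 * b + c = - (d + - a - 2 * - b + - c)" by simp
    then show ?thesis
      unfolding local_differences_def mem_Collect_eq by (metis minus_minus sgn_minus)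
  qed
  have "local_differences (- a) (- b) (- c) = uminus ` local_differences a b c"
    unfolding set_eq_iff mem by (metis (no_types, lifting) image_iff minus_minus)
  then show ?thesis by (simp add: card_image)
qed

lemma N_uminus: "b \<in> {-1, 0, 1} \<Longrightarrow> N (- a) (- b) m = N a b m"
proof (induction m arbitrary: a b)
  case 0
  then show ?case using card_local_differences_uminus[of a b 0] by (simp add: N_0)
next
  case (Suc m)
  have b: "- b \<in> {-1, 0, 1}" using Suc.prems by auto
  have "N (- a) (- b) (Suc m)
      = (\<Sum>c\<in>{-1, 0, 1}. card (local_differences (- a) (- b) (- c)) * N (- b) (- c) m)"
    unfolding N_Suc[OF b] by simp
  also have "\<dots> = (\<Sum>c\<in>{-1, 0, 1}. card (local_differences a b c) * N b c m)"
    by (intro sum.cong refl) (simp only: card_local_differences_uminus Suc.IH)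
  finally show ?case
    using N_Suc[OF Suc.prems] by simp
qed

lemma N_neg: "N a (-1) m = N (- a) 1 m"
  using N_uminus[of "-1" a m] by simp

section \<open>Recurrences up to sign and their elimination\<close>

lemma N_pos_0: "N a 1 0 = nat (1 - a)"
  by (simp add: N_0 local_differences_pos)

text \<open>The three terms belong to the next signs -1, 0 and 1; in the first,
  \<open>N 1 (-1) m\<close> has been negated to \<open>N (-1) 1 m\<close>.\<close>

lemma N_pos_Suc:
  "N a 1 (Suc m) = nat (2 - a) * N (-1) 1 m + nat (1 - a) * N 1 0 m + nat (- a) * N 1 1 m"
  by (simp add: N_Suc local_differences_pos N_neg)

lemma N_1_zero_0: "N 1 0 0 = 0"
  by (simp add: N_0 local_differences_zero)

text \<open>A zero after a positive difference forces a negative one next, and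
  \<open>N 0 (-1) m\<close> equals \<open>N 0 1 m\<close> by symmetry.\<close>

lemma N_1_zero_Suc: "N 1 0 (Suc m) = N 0 1 m"
  by (simp add: N_Suc local_differences_zero N_neg)

lemmas N_recs = N_pos_0 N_pos_Suc N_1_zero_0 N_1_zero_Suc

lemma N_0_1_Suc_Suc: "N 0 1 (Suc (Suc m)) = 2 * N (-1) 1 (Suc m) + N 0 1 m"
  by (simp add: N_pos_Suc[of 0] N_1_zero_Suc)

text \<open>The weights for \<open>a = -1\<close> are 3, 2, 1. The term \<open>N 1 1 (Suc m)\<close>
  collapses to \<open>N (-1) 1 m\<close>, because only a negative sign can follow two positive
  ones.\<close>

lemma N_minus_1_1_Suc_Suc:
  "N (-1) 1 (Suc (Suc m)) = 3 * N (-1) 1 (Suc m) + N (-1) 1 m + 2 * N 0 1 m"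
  by (simp add: N_pos_Suc[of "-1" "Suc m"] N_pos_Suc[of 1] N_1_zero_Suc)

text \<open>With \<open>x m = N 0 1 m\<close> and \<open>y m = N (-1) 1 m\<close>, the first
  recurrence gives \<open>2 * y (m + 1) = x (m + 2) - x m\<close>. Doubling
  \<open>y (m + 3) = 3 * y (m + 2) + y (m + 1) + 2 * x (m + 1)\<close> and substituting removes
  \<open>y\<close>.\<close>

lemma N_0_1_recurrence:
  "int (N 0 1 (m + 4)) = 3 * int (N 0 1 (m + 3)) + 2 * int (N 0 1 (m + 2))
    + int (N 0 1 (m + 1)) - int (N 0 1 m)"
proof -
  have eqs: "m + 4 = Suc (Suc (Suc (Suc m)))" "m + 3 = Suc (Suc (Suc m))" "m + 2 = Suc (Suc m)"
    "m + 1 = Suc m"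
    by simp_all
  show ?thesis
    unfolding eqs using N_0_1_Suc_Suc[of "Suc (Suc m)"] N_0_1_Suc_Suc[of "Suc m"] N_0_1_Suc_Suc[of m]
      N_minus_1_1_Suc_Suc[of "Suc m"]
    by simp
qed

section \<open>From list counts to \<open>T\<close>\<close>

text \<open>If no chips arrive from the left, a zero difference can stay zero only if the next one
  is zero too, so a leading zero propagates through the whole list.\<close>

lemma reversing_nonzero_iff_hd:
  "reversing 0 ds \<Longrightarrow> (\<exists>d\<in>set ds. d \<noteq> 0) \<longleftrightarrow> ds \<noteq> [] \<and> sgn (hd ds) \<noteq> 0"
proof (induction ds)
  case (Cons d ds)
  show ?case
  proof (cases "d = 0")
    case True
    with Cons.prems have "reversing 0 ds" "ds \<noteq> [] \<longrightarrow> sgn (hd ds) = 0"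
      by (auto split: if_splits)
    with Cons.IH True show ?thesis by auto
  qed (simp add: sgn_0_0)
qed simp

lemma nonzero_reversing_lists:
  "{ds. length ds = Suc m \<and> reversing 0 ds \<and> (\<exists>d\<in>set ds. d \<noteq> 0)}
    = reversing_lists 0 1 m \<union> reversing_lists 0 (-1) m"
proof -
  have "sgn x \<noteq> 0 \<longleftrightarrow> sgn x = 1 \<or> sgn x = -1" for x :: int
    by (auto simp: sgn_if)
  then show ?thesis
    using reversing_nonzero_iff_hd by (auto simp: reversing_lists_def)
qed

lemma path_p2_configurations_1: "path_p2_configurations 1 = {}"
  using bij_betw_differences[of 1] by (auto simp: bij_betw_def cong: conj_cong)

lemma finite_path_p2_configurations:
  assumes "n \<ge> 1"
  shows "finite (path_p2_configurations n)"
proof (cases "n = 1")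
  case False
  with assms have "n - 1 = Suc (n - 2)" by simp
  then show ?thesis
    using bij_betw_finite[OF bij_betw_differences[OF assms]]
    by (simp only: nonzero_reversing_lists) (simp add: finite_reversing_lists)
qed (simp only: path_p2_configurations_1 finite.emptyI)

lemma T_1: "T 1 = 0"
  unfolding T_def path_p2_configurations_1 by simp

text \<open>A path on \<open>m + 2\<close> vertices has \<open>m + 1\<close> differences, and the
  first one is positive or negative equally often.\<close>

lemma T_add_2: "T (m + 2) = 2 * N 0 1 m"
proof -
  have eq: "m + 2 - 1 = Suc m" by simp
  have "T (m + 2) = card (reversing_lists 0 1 m \<union> reversing_lists 0 (-1) m)"
    using bij_betw_same_card[OF bij_betw_differences[of "m + 2"]]
    unfolding T_def eq nonzero_reversing_lists by simp
  also have "\<dots> = N 0 1 m + N 0 (-1) m"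
    unfolding N_def
    by (rule card_Un_disjoint[OF finite_reversing_lists finite_reversing_lists])
       (auto simp: reversing_lists_def)
  finally show ?thesis by (simp add: N_neg)
qed

theorem theorem6:
  shows "(\<forall>n\<ge>1. finite (path_p2_configurations n)) \<and>
    T 1 = 0 \<and> T 2 = 2 \<and> T 3 = 8 \<and> T 4 = 26 \<and>
    (\<forall>n\<ge>5. int (T n) =
       3 * int (T (n - 1)) + 2 * int (T (n - 2)) + int (T (n - 3)) - int (T (n - 4)))"
proof -
  have N: "N 0 1 0 = 1" "N 0 1 1 = 4" "N 0 1 2 = 13" "N 0 1 3 = 48"
    by (simp_all add: N_recs numeral_2_eq_2 numeral_3_eq_3)
  have T: "T 2 = 2" "T 3 = 8" "T 4 = 26" "T 5 = 96"
    using T_add_2[of 0] T_add_2[of 1] T_add_2[of 2] T_add_2[of 3] N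
    by (simp_all flip: numeral_2_eq_2 numeral_3_eq_3)
  have "int (T n) =
      3 * int (T (n - 1)) + 2 * int (T (n - 2)) + int (T (n - 3)) - int (T (n - 4))" if "n \<ge> 5" for n
  \<comment> \<open>For \<open>n = 5\<close> the recurrence reaches \<open>T 1\<close>, which
    \<open>T_add_2\<close> does not cover, so this case is checked by computed values.\<close>
  proof (cases "n = 5")
    case True
    then show ?thesis using T T_1 by simp
  next
    case False
    with that have "n = (n - 6) + 4 + 2" by simp
    then obtain m where m: "n = m + 4 + 2" ..
    then have pred: "n - 1 = m + 3 + 2" "n - 2 = m + 2 + 2" "n - 3 = m + 1 + 2" "n - 4 = m + 2"
      by simp_all
    show ?thesis
      unfolding pred unfolding m T_add_2 using N_0_1_recurrence[of m] by simp
  qed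
  then show ?thesis
    using finite_path_p2_configurations T_1 T by simp
qed

end
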